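(* For every integer $n\ge 2$, the space $\mathcal{F}_{2n,n}^{\mathbb{R}}$ of $2n$-vector unit-norm tight frames in $\mathbb{R}^n$ has at most two connected components, and its quotient under the natural action of the orthogonal group $O(n)$ is connected.
   Context: For $k\ge n\ge 1$, a finite unit-norm tight frame with $k$ vectors in $\mathbb{R}^n$ is a sequence $(x_1,\dots,x_k)$ of unit vectors of $\mathbb{R}^n$ such that $y=\frac{n}{k}\sum_{j=1}^{k}\langle y,x_j\rangle x_j$ for all $y\in\mathbb{R}^n$. $\mathcal{F}_{k,n}^{\mathbb{R}}$ denotes the set of all such sequences, with the topology inherited from $(\mathbb{R}^n)^k$. The natural action of $O(n)$ is $U\cdot(x_1,\dots,x_k)=(Ux_1,\dots,Ux_k)$, and the quotient has the quotient topology. *)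

theory Defs
  imports "HOL-Analysis.Analysis"
begin

text \<open>A sequence of \<open>k = CARD('k)\<close> vectors in \<open>\<real>\<^sup>n\<close>, \<open>n = CARD('n)\<close>, is a point of \<open>real^'n^'k\<close>,
  whose topology is the product topology on \<open>k\<close> copies of \<open>real^'n\<close>.\<close>

definition unit_norm_tight_frames :: "(real^'n^'k) set" where
  "unit_norm_tight_frames =
    {x. (\<forall>j. norm (x $ j) = 1) \<and>
        (\<forall>y. y = (real CARD('n) / real CARD('k)) *\<^sub>R (\<Sum>j\<in>UNIV. (y \<bullet> (x $ j)) *\<^sub>R (x $ j)))}"

definition frame_action :: "real^'n^'n \<Rightarrow> real^'n^'k \<Rightarrow> real^'n^'k" where
  "frame_action U x = (\<chi> j. U *v (x $ j))"

definition frame_orbit :: "real^'n^'k \<Rightarrow> (real^'n^'k) set" where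
  "frame_orbit x = {frame_action U x | U. orthogonal_matrix U}"

text \<open>The quotient topology on \<open>q ` topspace X\<close>; the quotient of \<open>X\<close> by a group action is the
  instance where \<open>q\<close> sends each point to its orbit.\<close>

definition quotient_topology :: "'a topology \<Rightarrow> ('a \<Rightarrow> 'b) \<Rightarrow> 'b topology" where
  "quotient_topology X q =
    topology (\<lambda>V. V \<subseteq> q ` topspace X \<and> openin X {x \<in> topspace X. q x \<in> V})"

lemma openin_quotient_topology:
  "openin (quotient_topology X q) V \<longleftrightarrow>
    V \<subseteq> q ` topspace X \<and> openin X {x \<in> topspace X. q x \<in> V}"
proof -
  have "istopology (\<lambda>V. V \<subseteq> q ` topspace X \<and> openin X {x \<in> topspace X. q x \<in> V})"
    unfolding istopology_def
  proof (intro conjI allI impI)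
    fix S T
    assume S: "S \<subseteq> q ` topspace X \<and> openin X {x \<in> topspace X. q x \<in> S}"
      and T: "T \<subseteq> q ` topspace X \<and> openin X {x \<in> topspace X. q x \<in> T}"
    show "S \<inter> T \<subseteq> q ` topspace X" using S by blast
    have "{x \<in> topspace X. q x \<in> S \<inter> T} =
        {x \<in> topspace X. q x \<in> S} \<inter> {x \<in> topspace X. q x \<in> T}" by blast
    then show "openin X {x \<in> topspace X. q x \<in> S \<inter> T}"
      using S T by (simp only: openin_Int)
  next
    fix \<K>
    assume K: "\<forall>K\<in>\<K>. K \<subseteq> q ` topspace X \<and> openin X {x \<in> topspace X. q x \<in> K}"
    then show "\<Union>\<K> \<subseteq> q ` topspace X" by blast
    have "{x \<in> topspace X. q x \<in> \<Union>\<K>} = (\<Union>K\<in>\<K>. {x \<in> topspace X. q x \<in> K})" by blast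
    moreover have "openin X (\<Union>K\<in>\<K>. {x \<in> topspace X. q x \<in> K})"
      using K by (intro openin_Union) auto
    ultimately show "openin X {x \<in> topspace X. q x \<in> \<Union>\<K>}" by simp
  qed
  then show ?thesis
    unfolding quotient_topology_def by (simp add: topology_inverse')
qed

lemma topspace_quotient_topology: "topspace (quotient_topology X q) = q ` topspace X"
proof
  show "topspace (quotient_topology X q) \<subseteq> q ` topspace X"
    using openin_topspace[of "quotient_topology X q"] unfolding openin_quotient_topology by (rule conjunct1)
  have "{x \<in> topspace X. q x \<in> q ` topspace X} = topspace X" by blast
  then have "openin (quotient_topology X q) (q ` topspace X)"
    by (simp add: openin_quotient_topology)
  then show "q ` topspace X \<subseteq> topspace (quotient_topology X q)"
    by (rule openin_subset)
qed

lemma quotient_map_quotient_topology: "quotient_map X (quotient_topology X q) q"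
  by (auto simp: quotient_map_def topspace_quotient_topology openin_quotient_topology)

lemma frame_action_mult: "frame_action U (frame_action V x) = frame_action (U ** V) x"
  by (simp add: frame_action_def vec_eq_iff matrix_vector_mul_assoc)

lemma frame_action_one: "frame_action (mat 1) x = x"
  by (simp add: frame_action_def vec_eq_iff)

lemma frame_orbit_eq_iff:
  "frame_orbit x = frame_orbit y \<longleftrightarrow> (\<exists>U. orthogonal_matrix U \<and> y = frame_action U x)"
proof
  assume "frame_orbit x = frame_orbit y"
  moreover have "y \<in> frame_orbit y"
    unfolding frame_orbit_def using frame_action_one[of y, symmetric] orthogonal_matrix_id by blast
  ultimately show "\<exists>U. orthogonal_matrix U \<and> y = frame_action U x"
    unfolding frame_orbit_def by blast
next
  have sub: "frame_orbit (frame_action V z) \<subseteq> frame_orbit z"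
    if "orthogonal_matrix V" for V :: "real^'a^'a" and z :: "real^'a^'b"
    using that orthogonal_matrix_mul unfolding frame_orbit_def
    by (fastforce simp only: frame_action_mult)
  assume "\<exists>U. orthogonal_matrix U \<and> y = frame_action U x"
  then obtain U where U: "orthogonal_matrix U" "y = frame_action U x" by blast
  then have "x = frame_action (transpose U) y" "orthogonal_matrix (transpose U)"
    by (simp_all add: frame_action_mult frame_action_one orthogonal_matrix_def)
  then show "frame_orbit x = frame_orbit y"
    using sub[of U x] sub[of "transpose U" y] U by simp
qed

lemma frame_action_tight_frames:
  fixes x :: "real^'n^'k"
  assumes U: "orthogonal_matrix U" and x: "x \<in> unit_norm_tight_frames"
  shows "frame_action U x \<in> unit_norm_tight_frames"
proof -
  define c where "c = real CARD('n) / real CARD('k)"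
  have "norm (frame_action U x $ j) = 1" for j
    using U x orthogonal_transformation_norm[of "(*v) U" "x $ j"]
    by (simp add: frame_action_def unit_norm_tight_frames_def orthogonal_transformation_matrix)
  moreover have "y = c *\<^sub>R (\<Sum>j\<in>UNIV. (y \<bullet> (frame_action U x $ j)) *\<^sub>R (frame_action U x $ j))" for y
  proof -
    have tf: "transpose U *v y =
        c *\<^sub>R (\<Sum>j\<in>UNIV. ((transpose U *v y) \<bullet> (x $ j)) *\<^sub>R (x $ j))"
      using x unfolding unit_norm_tight_frames_def c_def by blast
    have "y = U *v (transpose U *v y)"
      using U by (simp add: orthogonal_matrix_def matrix_vector_mul_assoc del: transpose_matrix_vector)
    also have "\<dots> = U *v (c *\<^sub>R (\<Sum>j\<in>UNIV. ((transpose U *v y) \<bullet> (x $ j)) *\<^sub>R (x $ j)))"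
      using tf by (rule arg_cong)
    also have "\<dots> = c *\<^sub>R (\<Sum>j\<in>UNIV. ((transpose U *v y) \<bullet> (x $ j)) *\<^sub>R (U *v (x $ j)))"
      by (simp add: linear_sum[OF matrix_vector_mul_linear] linear_cmul[OF matrix_vector_mul_linear]
          del: transpose_matrix_vector)
    also have "\<dots> = c *\<^sub>R (\<Sum>j\<in>UNIV. (y \<bullet> (U *v (x $ j))) *\<^sub>R (U *v (x $ j)))"
      by (simp add: dot_lmul_matrix)
    finally show ?thesis by (simp add: frame_action_def)
  qed
  ultimately show ?thesis unfolding unit_norm_tight_frames_def c_def by blast
qed

end

theory Submission
  imports Defs
begin

text \<open>Since \<open>k = 2n\<close>, the frame operator of a frame is \<open>2\<close> times the identity.  Let \<open>m = \<langle>x\<^sub>i, x\<^sub>j\<rangle>\<close>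
  and suppose \<open>0 < \<bar>m\<bar> < 1\<close>.  A Lagrange multiplier for \<open>m\<close> under the frame constraints is a
  symmetric form for which every \<open>x\<^sub>l\<close> with \<open>l \<noteq> i, j\<close> and both \<open>x\<^sub>i \<plusminus> x\<^sub>j\<close> are eigenvectors,
  \<open>x\<^sub>i + x\<^sub>j\<close> and \<open>x\<^sub>i - x\<^sub>j\<close> having different eigenvalues; the trace of the frame operator on the
  eigenspace of \<open>x\<^sub>i + x\<^sub>j\<close> then shows that \<open>m\<close> is an integer.  So \<open>m\<close> is never critical and
  \<open>\<bar>m\<bar>\<close> can be increased along a path of frames; at a frame where the constraints degenerate, one
  moves only the vectors of the smallest orthogonal summand containing \<open>x\<^sub>i\<close> and \<open>x\<^sub>j\<close>.  By
  compactness every component contains a frame consisting of an orthonormal basis taken twice up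
  to signs.  Rotating orthogonal pairs of vectors by a right angle connects, up to the orthogonal
  group, any two of these: the pairing and the signs can be changed at will when \<open>n \<ge> 2\<close>.  Finally, a
  hyperplane reflection can be deformed into any other one, so an orthogonal transformation moves a
  frame to its own component or to that of a fixed reflected copy of it.\<close>

section \<open>Solving a quadratic equation along a line\<close>

text \<open>The linearization \<open>2 *\<^sub>R B x e\<close> need not be onto, so the inverse
  function theorem does not apply to it directly. Read by duality, the last hypothesis puts
  \<open>\<phi>\<close> and every \<open>B e e\<close> into its range on \<open>E\<close>, so the
  equation can be solved inside that range.\<close>

lemma quadratic_path:
  fixes B :: "'a::euclidean_space \<Rightarrow> 'a \<Rightarrow> 'b::euclidean_space"
  assumes B: "bounded_bilinear B" and sym: "\<And>u v. B u v = B v u"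
    and E: "subspace E"
    and ortho: "\<And>w. (\<And>e. e \<in> E \<Longrightarrow> w \<bullet> B x e = 0) \<Longrightarrow> w \<bullet> \<phi> = 0 \<and> (\<forall>e\<in>E. w \<bullet> B e e = 0)"
  obtains \<gamma> \<epsilon> where "\<epsilon> > 0" "continuous_on {0..\<epsilon>} \<gamma>" "\<gamma> 0 = x"
    "\<And>t. t \<in> {0..\<epsilon>} \<Longrightarrow> \<gamma> t - x \<in> E \<and> B (\<gamma> t) (\<gamma> t) = B x x + t *\<^sub>R \<phi>"
proof -
  interpret B: bounded_bilinear B by (rule B)
  define A where "A e = 2 *\<^sub>R B x e" for e
  have A: "linear A"
    unfolding A_def by (intro linearI) (auto simp: B.add_right B.scaleR_right algebra_simps)
  have subR: "subspace (A ` E)"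
    by (rule linear_subspace_image[OF A E])
  \<comment> \<open>The component \<open>w\<close> of \<open>z\<close> orthogonal to the range
    annihilates \<open>z\<close>, hence also itself, so it vanishes.\<close>
  have mem: "z \<in> A ` E" if "\<And>w. (\<And>e. e \<in> E \<Longrightarrow> w \<bullet> B x e = 0) \<Longrightarrow> w \<bullet> z = 0" for z
  proof -
    obtain y w where yw: "y \<in> span (A ` E)" "\<And>u. u \<in> span (A ` E) \<Longrightarrow> orthogonal w u" "z = y + w"
      using orthogonal_subspace_decomp_exists[of "A ` E" z] by metis
    have "w \<bullet> B x e = 0" if "e \<in> E" for e
      using yw(2)[OF span_base, of "A e"] that by (simp add: orthogonal_def A_def)
    then have "w \<bullet> z = 0" by (rule that)
    moreover have "w \<bullet> y = 0" using yw(1,2) by (simp add: orthogonal_def)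
    ultimately have "w = 0" using yw(3) by (simp add: inner_add_right)
    then show ?thesis using yw subR by (simp add: span_eq_iff[THEN iffD2])
  qed
  have phi: "\<phi> \<in> A ` E" and BE: "B e e \<in> A ` E" if "e \<in> E" for e
    using ortho that by (auto intro!: mem)
  \<comment> \<open>With \<open>L\<close> a right inverse of \<open>A\<close> on its range, \<open>\<gamma> t = x + L y\<close> works as soon as \<open>y + B (L y) (L y) = t\<phi>\<close>,
    because this equation forces \<open>y\<close> into the range of \<open>A\<close>.\<close>
  obtain L where L: "linear L" "range L \<subseteq> E" "\<And>v. v \<in> A ` E \<Longrightarrow> A (L v) = v"
    using linear_exists_right_inverse_on[OF A E] by (auto simp: image_subset_iff)
  have bL: "bounded_linear L" using L(1) by (simp add: linear_conv_bounded_linear)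
  define h where "h y = y + B (L y) (L y)" for y
  define C where "C y = Blinfun (\<lambda>k. B (L y) (L k))" for y
  define D where "D y = id_blinfun + 2 *\<^sub>R C y" for y
  have bl: "bounded_linear (\<lambda>k. B (L y) (L k))" for y
    by (intro B.bounded_linear_right[THEN bounded_linear_compose] bL)
  have C_apply: "blinfun_apply (C y) k = B (L y) (L k)" for y k
    by (simp add: C_def bounded_linear_Blinfun_apply[OF bl])
  have D_apply: "blinfun_apply (D y) k = k + 2 *\<^sub>R B (L y) (L k)" for y k
    by (simp add: D_def plus_blinfun.rep_eq scaleR_blinfun.rep_eq C_apply)
  have der: "(h has_derivative blinfun_apply (D y)) (at y)" for y
  proof -
    have "(h has_derivative (\<lambda>k. k + (B (L y) (L k) + B (L k) (L y)))) (at y)"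
      unfolding h_def
      by (intro has_derivative_add has_derivative_ident B.FDERIV bL[THEN bounded_linear_imp_has_derivative])
    then show ?thesis by (simp add: sym scaleR_2 D_apply[abs_def])
  qed
  have "linear C"
    by (intro linearI blinfun_eqI)
      (auto simp: C_apply plus_blinfun.rep_eq scaleR_blinfun.rep_eq
        linear_add[OF L(1)] linear_cmul[OF L(1)] B.add_left B.scaleR_left)
  then have contD: "continuous_on UNIV D"
    unfolding D_def by (intro continuous_intros linear_continuous_on)
      (simp add: linear_conv_bounded_linear)
  have L0: "L 0 = 0" by (rule linear_0[OF L(1)])
  \<comment> \<open>The quadratic part of \<open>h\<close> has derivative zero at 0, so the
    derivative of \<open>h\<close> there is the identity, which is its own inverse.\<close>
  have D0: "id_blinfun o\<^sub>L D 0 = id_blinfun"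
    by (intro blinfun_eqI) (simp add: D_apply L0 B.zero_left)
  obtain U V g where UV: "open V" "h 0 \<in> V" "0 \<in> U" "homeomorphism U V h g"
    using inverse_function_theorem[of UNIV h D 0 id_blinfun, OF open_UNIV der contD UNIV_I D0] by metis
  have h0: "h 0 = 0" by (simp add: h_def L0 B.zero_left)
  \<comment> \<open>The summand 1 covers \<open>\<phi> = 0\<close>. With this \<open>c\<close>, all
    \<open>t *\<^sub>R \<phi>\<close> for \<open>t \<le> d * c\<close> stay in the ball of radius
    \<open>d\<close>.\<close>
  define c where "c = 1 / (1 + norm \<phi>)"
  have c: "c > 0" "c * norm \<phi> < 1"
    by (auto simp: c_def add_pos_nonneg divide_simps)
  obtain d where d: "d > 0" "ball 0 d \<subseteq> V" using UV(1,2) h0 openE by metis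
  define \<epsilon> where "\<epsilon> = d * c"
  have inV: "t *\<^sub>R \<phi> \<in> V" if "t \<in> {0..\<epsilon>}" for t
  proof -
    have "norm (t *\<^sub>R \<phi>) \<le> \<epsilon> * norm \<phi>" using that by (simp add: mult_right_mono)
    also have "\<dots> < d" using c d by (simp add: \<epsilon>_def mult.assoc)
    finally show ?thesis using d(2) by auto
  qed
  define \<gamma> where "\<gamma> t = x + L (g (t *\<^sub>R \<phi>))" for t
  show ?thesis
  proof
    show "\<epsilon> > 0" using c d by (simp add: \<epsilon>_def)
    have "continuous_on {0..\<epsilon>} (\<lambda>t. g (t *\<^sub>R \<phi>))"
    proof (rule continuous_on_compose2[of V g])
      show "continuous_on V g" using UV(4) by (simp add: homeomorphism_def)
      show "continuous_on {0..\<epsilon>} (\<lambda>t. t *\<^sub>R \<phi>)" by (intro continuous_intros)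
      show "(\<lambda>t. t *\<^sub>R \<phi>) ` {0..\<epsilon>} \<subseteq> V" using inV by blast
    qed
    then show "continuous_on {0..\<epsilon>} \<gamma>"
      unfolding \<gamma>_def by (intro continuous_on_add continuous_on_const bounded_linear.continuous_on[OF bL])
    have "g 0 = 0" using UV(3,4) h0 by (metis homeomorphism_apply1)
    then show "\<gamma> 0 = x" by (simp add: \<gamma>_def L0)
  next
    fix t assume t: "t \<in> {0..\<epsilon>}"
    define y where "y = g (t *\<^sub>R \<phi>)"
    have "h y = t *\<^sub>R \<phi>" using UV(4) inV[OF t] unfolding y_def by (metis homeomorphism_apply2)
    then have y: "y + B (L y) (L y) = t *\<^sub>R \<phi>" by (simp add: h_def)
    have LE: "L y \<in> E" using L(2) by auto
    have "t *\<^sub>R \<phi> - B (L y) (L y) \<in> A ` E"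
      using subR phi[OF LE] BE[OF LE] by (simp add: subspace_diff subspace_scale)
    then have "y \<in> A ` E" using y by (metis add_diff_cancel_right')
    then have ALy: "A (L y) = y" by (rule L(3))
    have "B (\<gamma> t) (\<gamma> t) = B x x + (A (L y) + B (L y) (L y))"
      by (simp add: \<gamma>_def y_def[symmetric] B.add_left B.add_right sym[of "L y" x] A_def scaleR_2)
    then have "B (\<gamma> t) (\<gamma> t) = B x x + t *\<^sub>R \<phi>"
      using y ALy by simp
    then show "\<gamma> t - x \<in> E \<and> B (\<gamma> t) (\<gamma> t) = B x x + t *\<^sub>R \<phi>"
      using LE by (simp add: \<gamma>_def y_def)
  qed
qed

section \<open>Half-tight frames and their constraints\<close>

text \<open>This is the tight frame condition with the factor n/k = 1/2 cleared, so that no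
  cardinality occurs in it.\<close>

definition half_tight_frames :: "(real^'n^'k) set" where
  "half_tight_frames = {x. (\<forall>j. norm (x $ j) = 1) \<and> (\<forall>v. (\<Sum>j\<in>UNIV. (v \<bullet> x $ j) *\<^sub>R x $ j) = 2 *\<^sub>R v)}"

lemma unit_norm_tight_frames_eq_half_tight:
  assumes "CARD('k) = 2 * CARD('n)"
  shows "(unit_norm_tight_frames :: (real^'n^'k) set) = half_tight_frames"
proof -
  have "(v = (1/2) *\<^sub>R u) \<longleftrightarrow> (u = 2 *\<^sub>R v)" for u v :: "real^'n"
    by auto
  then show ?thesis
    using assms by (simp add: unit_norm_tight_frames_def half_tight_frames_def)
qed

lemma half_tight_inner_self:
  "x \<in> half_tight_frames \<Longrightarrow> x $ j \<bullet> x $ j = 1"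
  by (simp add: half_tight_frames_def dot_square_norm)

lemma half_tight_sum_inner:
  assumes "x \<in> half_tight_frames"
  shows "(\<Sum>j\<in>UNIV. (v \<bullet> x $ j) * (u \<bullet> x $ j)) = 2 * (v \<bullet> u)"
proof -
  have "u \<bullet> (\<Sum>j\<in>UNIV. (v \<bullet> x $ j) *\<^sub>R x $ j) = u \<bullet> (2 *\<^sub>R v)"
    using assms by (simp add: half_tight_frames_def)
  then show ?thesis by (simp add: inner_sum_right inner_commute[of v u])
qed

text \<open>Both sides are the trace of one quadratic form on the span. In an orthonormal basis each
  \<open>c l\<close> contributes its squared length by Parseval. The weight 1/2 suits
  \<open>p = x $ i + x $ j\<close> on vectors having equal inner products with both
  summands.\<close>

lemma trace_identity:
  fixes c :: "'i \<Rightarrow> 'a::euclidean_space"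
  assumes I: "finite I" and unit: "\<And>l. l \<in> I \<Longrightarrow> c l \<bullet> c l = 1"
    and tight: "\<And>v. v \<in> span (insert p (c ` I)) \<Longrightarrow> (\<Sum>l\<in>I. (v \<bullet> c l)\<^sup>2) + (v \<bullet> p)\<^sup>2 / 2 = 2 * (v \<bullet> v)"
  shows "real (card I) + (p \<bullet> p) / 2 = 2 * real (dim (insert p (c ` I)))"
proof -
  define S where "S = span (insert p (c ` I))"
  obtain Q where Q: "Q \<subseteq> S" "pairwise orthogonal Q" "\<And>v. v \<in> Q \<Longrightarrow> norm v = 1"
      "independent Q" "card Q = dim S" "span Q = S"
    using orthonormal_basis_subspace[of S] by (auto simp: S_def)
  have fin: "finite Q" using Q(4) by (rule independent_imp_finite)
  have pars: "(\<Sum>b\<in>Q. (b \<bullet> u)\<^sup>2) = u \<bullet> u" if "u \<in> S" for u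
  proof -
    have "(\<Sum>b\<in>Q. (u \<bullet> b) *\<^sub>R b) = u"
      using orthonormal_basis_expand[OF Q(2) Q(3) _ fin] that Q(6) by simp
    then have "u \<bullet> (\<Sum>b\<in>Q. (u \<bullet> b) *\<^sub>R b) = u \<bullet> u" by simp
    then show ?thesis by (simp add: inner_sum_left inner_sum_right inner_commute power2_eq_square)
  qed
  have inS: "p \<in> S" "\<And>l. l \<in> I \<Longrightarrow> c l \<in> S" by (auto simp: S_def intro: span_base)
  have "2 * real (card Q) = (\<Sum>b\<in>Q. 2 * (b \<bullet> b))"
    using Q(3) by (simp add: dot_square_norm)
  also have "\<dots> = (\<Sum>b\<in>Q. (\<Sum>l\<in>I. (b \<bullet> c l)\<^sup>2) + (b \<bullet> p)\<^sup>2 / 2)"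
    using Q(1) by (intro sum.cong refl) (simp add: S_def subset_iff tight)
  also have "\<dots> = (\<Sum>l\<in>I. \<Sum>b\<in>Q. (b \<bullet> c l)\<^sup>2) + (\<Sum>b\<in>Q. (b \<bullet> p)\<^sup>2) / 2"
    by (simp add: sum.distrib sum_divide_distrib sum.swap[of _ I])
  also have "\<dots> = real (card I) + (p \<bullet> p) / 2"
    by (simp add: pars inS unit)
  finally show ?thesis using Q(5) by (simp add: S_def)
qed

text \<open>Polarization of the quadratic map sending a family to its frame operator, its squared norms
  and the objective \<open>\<langle>x\<^sub>i, x\<^sub>j\<rangle>\<close>.\<close>

definition frame_bilinear ::
    "'k \<Rightarrow> 'k \<Rightarrow> real^'n^'k \<Rightarrow> real^'n^'k \<Rightarrow> (real^'n^'n) \<times> (real^'k) \<times> real" where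
  "frame_bilinear i j u v =
    ((\<chi> a b. (\<Sum>l\<in>UNIV. (u $ l $ a * v $ l $ b + v $ l $ a * u $ l $ b) / 2)),
     (\<chi> l. u $ l \<bullet> v $ l),
     (u $ i \<bullet> v $ j + v $ i \<bullet> u $ j) / 2)"

lemma frame_bilinear_commute: "frame_bilinear i j u v = frame_bilinear i j v u"
  by (simp add: frame_bilinear_def vec_eq_iff inner_commute add.commute)

lemma bounded_bilinear_frame_bilinear:
  "bounded_bilinear (frame_bilinear i j :: real^'n^'k \<Rightarrow> _)"
proof -
  have lin: "linear (frame_bilinear i j u)" for u :: "real^'n^'k"
    by (intro linearI)
      (auto simp: frame_bilinear_def vec_eq_iff algebra_simps inner_simps sum.distrib sum_distrib_left
        add_divide_distrib)
  moreover have "linear (\<lambda>u. frame_bilinear i j u v)" for v :: "real^'n^'k"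
    using lin[of v] by (subst frame_bilinear_commute)
  ultimately show ?thesis
    by (simp add: bilinear_def flip: bilinear_conv_bounded_bilinear)
qed

text \<open>The contribution of a multiplier \<open>S\<close>, not assumed symmetric, of the frame operator equation.\<close>

definition multiplier_form :: "real^'n^'n \<Rightarrow> real^'n \<Rightarrow> real^'n \<Rightarrow> real" where
  "multiplier_form S u v = (u \<bullet> (S *v v) + v \<bullet> (S *v u)) / 2"

lemma multiplier_form_simps:
  "multiplier_form S u v = multiplier_form S v u"
  "multiplier_form S u 0 = 0"
  "multiplier_form S u (v + w) = multiplier_form S u v + multiplier_form S u w"
  "multiplier_form S u (c *\<^sub>R v) = c * multiplier_form S u v"
  by (auto simp: multiplier_form_def matrix_vector_right_distrib inner_simps
      matrix_vector_mult_scaleR algebra_simps add_divide_distrib)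

text \<open>The triple is a Lagrange multiplier: \<open>S\<close> for the frame operator,
  \<open>d\<close> for the norms, \<open>r\<close> for the objective. The formula turns stationarity
  into equations between the single vectors.\<close>

lemma inner_frame_bilinear:
  "(S, d, r) \<bullet> frame_bilinear i j u v =
    (\<Sum>l\<in>UNIV. multiplier_form S (u $ l) (v $ l)) + (\<Sum>l\<in>UNIV. d $ l * (u $ l \<bullet> v $ l))
    + r * (u $ i \<bullet> v $ j + v $ i \<bullet> u $ j) / 2"
proof -
  have form: "multiplier_form S y z = (\<Sum>a\<in>UNIV. \<Sum>b\<in>UNIV. S $ a $ b * ((y $ a * z $ b + z $ a * y $ b) / 2))"
    for y z :: "real^'a"
    by (simp add: multiplier_form_def inner_vec_def matrix_vector_mult_def sum_distrib_left
        sum_divide_distrib algebra_simps add_divide_distrib sum.distrib)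
  have "(\<Sum>l\<in>UNIV. multiplier_form S (u $ l) (v $ l)) =
    (\<Sum>a\<in>UNIV. \<Sum>l\<in>UNIV. \<Sum>b\<in>UNIV. S $ a $ b * ((u $ l $ a * v $ l $ b + v $ l $ a * u $ l $ b) / 2))"
    unfolding form by (rule sum.swap)
  also have "\<dots> = (\<Sum>a\<in>UNIV. \<Sum>b\<in>UNIV. \<Sum>l\<in>UNIV. S $ a $ b * ((u $ l $ a * v $ l $ b + v $ l $ a * u $ l $ b) / 2))"
    by (intro sum.cong refl sum.swap)
  also have "\<dots> = S \<bullet> fst (frame_bilinear i j u v)"
    by (simp add: frame_bilinear_def inner_vec_def sum_distrib_left)
  finally show ?thesis
    by (simp add: frame_bilinear_def inner_vec_def)
qed

text \<open>The direction \<open>(0, 0, s)\<close> leaves the frame operator and the norms alone and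
  moves only the objective.\<close>

lemma frame_bilinear_step:
  assumes x: "x \<in> half_tight_frames"
    and y: "frame_bilinear i j y y = frame_bilinear i j x x + t *\<^sub>R (0, 0, s)"
  shows "y \<in> half_tight_frames" "y $ i \<bullet> y $ j = x $ i \<bullet> x $ j + t * s"
proof -
  have mat: "(\<Sum>l\<in>UNIV. y $ l $ a * y $ l $ b) = (\<Sum>l\<in>UNIV. x $ l $ a * x $ l $ b)" for a b
    using y by (simp add: frame_bilinear_def vec_eq_iff mult.commute)
  have nrm: "y $ l \<bullet> y $ l = x $ l \<bullet> x $ l" for l
    using y by (simp add: frame_bilinear_def vec_eq_iff)
  have comp: "(\<Sum>l\<in>UNIV. (v \<bullet> z $ l) *\<^sub>R z $ l) $ b = (\<Sum>a\<in>UNIV. v $ a * (\<Sum>l\<in>UNIV. z $ l $ a * z $ l $ b))"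
    for v b and z :: "real^'a^'b"
    unfolding sum_distrib_left
    by (subst sum.swap) (simp add: inner_vec_def sum_distrib_right mult.assoc)
  have "(\<Sum>l\<in>UNIV. (v \<bullet> y $ l) *\<^sub>R y $ l) = (\<Sum>l\<in>UNIV. (v \<bullet> x $ l) *\<^sub>R x $ l)" for v
    unfolding vec_eq_iff comp by (simp add: mat)
  then show "y \<in> half_tight_frames"
    using x nrm by (simp add: half_tight_frames_def norm_eq_sqrt_inner)
  show "y $ i \<bullet> y $ j = x $ i \<bullet> x $ j + t * s"
    using y by (simp add: frame_bilinear_def inner_commute)
qed

text \<open>The vectors outside \<open>J0\<close> are orthogonal to those inside and can stay
  frozen. The path comes from \<open>quadratic_path\<close>; its duality hypothesis is verified by
  excluding multipliers with \<open>r \<noteq> 0\<close> and showing that the others are scalar on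
  the span of the moving vectors.\<close>

lemma increase_abs_inner:
  fixes x :: "real^'n^'k"
  assumes x: "x \<in> half_tight_frames"
    and J0: "i \<in> J0" "j \<in> J0" "\<And>a l. a \<in> J0 \<Longrightarrow> l \<notin> J0 \<Longrightarrow> x $ a \<bullet> x $ l = 0"
    and m: "x $ i \<bullet> x $ j \<noteq> 0" "\<bar>x $ i \<bullet> x $ j\<bar> < 1"
  obtains C y where "connected C" "C \<subseteq> half_tight_frames" "x \<in> C" "y \<in> C"
    "\<And>z l. z \<in> C \<Longrightarrow> l \<notin> J0 \<Longrightarrow> z $ l = x $ l" "\<bar>y $ i \<bullet> y $ j\<bar> > \<bar>x $ i \<bullet> x $ j\<bar>"
proof -
  \<comment> \<open>Minimality of \<open>J\<close> makes the constraints nondegenerate for variations of the vectors indexed by \<open>J\<close>.\<close>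
  define admissible where "admissible J \<longleftrightarrow> i \<in> J \<and> j \<in> J \<and> J \<subseteq> J0 \<and> (\<forall>a\<in>J. \<forall>l. l \<notin> J \<longrightarrow> x $ a \<bullet> x $ l = 0)" for J
  have "finite {J. admissible J}" "{J. admissible J} \<noteq> {}"
    using J0 by (auto simp: admissible_def)
  from finite_has_minimal[OF this] obtain J where J: "admissible J" and
    Jmin: "\<And>J'. admissible J' \<Longrightarrow> J' \<subseteq> J \<Longrightarrow> J' = J" by blast
  have ijJ: "i \<in> J" "j \<in> J" "J \<subseteq> J0" and Jcl: "\<And>a l. a \<in> J \<Longrightarrow> l \<notin> J \<Longrightarrow> x $ a \<bullet> x $ l = 0"
    using J by (auto simp: admissible_def)
  note xx = half_tight_inner_self[OF x]
  have ij: "i \<noteq> j" using m(2) xx by auto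
  define W where "W = span (($) x ` J)"
  have xW: "x $ l \<in> W" if "l \<in> J" for l using that by (auto simp: W_def intro: span_base)
  define E where "E = {e :: real^'n^'k. (\<forall>l\<in>J. e $ l \<in> W) \<and> (\<forall>l. l \<notin> J \<longrightarrow> e $ l = 0)}"
  have E: "subspace E"
    by (auto simp: E_def W_def subspace_def intro: span_add span_scale span_zero)
  define s where "s = sgn (x $ i \<bullet> x $ j)"
  define \<phi> :: "(real^'n^'n) \<times> (real^'k) \<times> real" where "\<phi> = (0, 0, s)"
  have ortho: "w \<bullet> \<phi> = 0 \<and> (\<forall>e\<in>E. w \<bullet> frame_bilinear i j e e = 0)"
    if w: "\<And>e. e \<in> E \<Longrightarrow> w \<bullet> frame_bilinear i j x e = 0" for w
  proof -
    obtain S d r where wSdr: "w = (S, d, r)" by (cases w)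
    define b where "b = multiplier_form S"
    note b_simps = multiplier_form_simps[of S, folded b_def]
    \<comment> \<open>Stationarity is tested on the variation of the single vector
      \<open>x $ l\<close> in the direction \<open>v\<close>.\<close>
    have key: "b v (x $ l) + d $ l * (v \<bullet> x $ l)
        + r / 2 * ((if l = i then v \<bullet> x $ j else 0) + (if l = j then v \<bullet> x $ i else 0)) = 0"
      if l: "l \<in> J" and v: "v \<in> W" for l v
    proof -
      have ax: "axis l v $ a = (if a = l then v else 0)" for a
        by (simp add: axis_def)
      have "axis l v \<in> E" using l v by (auto simp: E_def ax W_def span_zero)
      then have "w \<bullet> frame_bilinear i j x (axis l v) = 0" by (rule w)
      moreover have "(\<Sum>a\<in>UNIV. b (x $ a) (axis l v $ a)) = b (x $ l) v"
      proof -
        have "(\<Sum>a\<in>UNIV. b (x $ a) (axis l v $ a)) = (\<Sum>a\<in>UNIV. if a = l then b (x $ a) v else 0)"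
          unfolding ax by (rule sum.cong) (auto simp: b_simps(2))
        then show ?thesis by simp
      qed
      moreover have "(\<Sum>a\<in>UNIV. d $ a * (x $ a \<bullet> axis l v $ a)) = d $ l * (x $ l \<bullet> v)"
      proof -
        have "(\<Sum>a\<in>UNIV. d $ a * (x $ a \<bullet> axis l v $ a)) = (\<Sum>a\<in>UNIV. if a = l then d $ a * (x $ a \<bullet> v) else 0)"
          unfolding ax by (rule sum.cong) auto
        then show ?thesis by simp
      qed
      moreover have "x $ i \<bullet> axis l v $ j = (if l = j then v \<bullet> x $ i else 0)"
        "axis l v $ i \<bullet> x $ j = (if l = i then v \<bullet> x $ j else 0)"
        by (auto simp: ax inner_commute)
      ultimately show ?thesis
        unfolding wSdr inner_frame_bilinear b_def[symmetric]
        by (auto simp: inner_commute[of "x $ l" v] b_simps(1)[of "x $ l" v] algebra_simps add_divide_distrib split: if_splits)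
    qed
    have "r = 0"
    proof (rule ccontr)
      assume r: "r \<noteq> 0"
      have "b (x $ j) (x $ i) + d $ i * (x $ i \<bullet> x $ j) + r / 2 = 0"
        "b (x $ i) (x $ j) + d $ j * (x $ i \<bullet> x $ j) + r / 2 = 0"
        using key[OF ijJ(1) xW[OF ijJ(2)]] key[OF ijJ(2) xW[OF ijJ(1)]] ij xx
        by (simp_all add: inner_commute)
      then have "d $ j * (x $ i \<bullet> x $ j) = d $ i * (x $ i \<bullet> x $ j)"
        using b_simps(1)[of "x $ i" "x $ j"] by linarith
      then have dij: "d $ j = d $ i" using m(1) by simp
      define p where "p = x $ i + x $ j"
      \<comment> \<open>Adding and subtracting the equations for \<open>i\<close> and
        \<open>j\<close> makes \<open>p\<close> and \<open>x $ i - x $ j\<close> eigenvectors on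
        \<open>W\<close> with eigenvalues \<open>- d $ i - r / 2\<close> and
        \<open>- d $ i + r / 2\<close>, while \<open>x $ l\<close> has eigenvalue
        \<open>- d $ l\<close>. Different eigenvalues of a symmetric form give
        orthogonality.\<close>
      have nonadj: "(d $ l - d $ i - r / 2) * (p \<bullet> x $ l) = 0"
          "(d $ l - d $ i + r / 2) * (x $ l \<bullet> x $ i - x $ l \<bullet> x $ j) = 0"
        if l: "l \<in> J" "l \<noteq> i" "l \<noteq> j" for l
      proof -
        have 1: "b (x $ l) (x $ i) + d $ i * (x $ l \<bullet> x $ i) + r / 2 * (x $ l \<bullet> x $ j) = 0"
          using key[OF ijJ(1) xW[OF l(1)]] ij by simp
        have 2: "b (x $ l) (x $ j) + d $ i * (x $ l \<bullet> x $ j) + r / 2 * (x $ l \<bullet> x $ i) = 0"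
          using key[OF ijJ(2) xW[OF l(1)]] ij dij by simp
        have 3: "b (x $ l) (x $ i) + d $ l * (x $ l \<bullet> x $ i) = 0"
            "b (x $ l) (x $ j) + d $ l * (x $ l \<bullet> x $ j) = 0"
          using key[OF l(1) xW[OF ijJ(1)]] key[OF l(1) xW[OF ijJ(2)]] l(2,3)
          by (simp_all add: inner_commute b_simps(1)[of "x $ l"])
        show "(d $ l - d $ i - r / 2) * (p \<bullet> x $ l) = 0"
          "(d $ l - d $ i + r / 2) * (x $ l \<bullet> x $ i - x $ l \<bullet> x $ j) = 0"
          using 1 2 3 by (simp_all add: p_def inner_simps inner_commute[of _ "x $ l"] algebra_simps)
      qed
      have sep: "x $ a \<bullet> x $ l = 0"
        if "a \<in> J" "l \<in> J" "a \<noteq> i" "a \<noteq> j" "l \<noteq> i" "l \<noteq> j" "d $ a \<noteq> d $ l" for a l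
      proof -
        have "b (x $ a) (x $ l) + d $ l * (x $ a \<bullet> x $ l) = 0"
          "b (x $ l) (x $ a) + d $ a * (x $ a \<bullet> x $ l) = 0"
          using key[OF that(2) xW[OF that(1)]] key[OF that(1) xW[OF that(2)]] that(3-6)
          by (simp_all add: inner_commute)
        then have "d $ l * (x $ a \<bullet> x $ l) = d $ a * (x $ a \<bullet> x $ l)"
          using b_simps(1)[of "x $ a" "x $ l"] by linarith
        then show ?thesis using that(7) by simp
      qed
      \<comment> \<open>\<open>V\<close> spans the eigenspace containing \<open>p\<close>; computing the trace of the frame operator on it makes the
        inner product of \<open>x $ i\<close> and \<open>x $ j\<close> an integer.\<close>
      define P where "P = {l \<in> J - {i, j}. d $ l = d $ i + r / 2}"
      define V where "V = insert p (($) x ` P)"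
      have Vout: "v \<bullet> x $ l = 0" if "v \<in> span V" "l \<notin> P" "l \<noteq> i" "l \<noteq> j" for v l
        using that(1)
      proof (induction rule: span_induct)
        case step
        then show ?case
        proof (cases "l \<in> J")
          case True
          then have "d $ l \<noteq> d $ i + r / 2" using that by (simp add: P_def)
          then have "p \<bullet> x $ l = 0" "\<And>a. a \<in> P \<Longrightarrow> x $ a \<bullet> x $ l = 0"
            using nonadj(1)[OF True] sep[OF _ True] that by (auto simp: P_def)
          then show ?thesis using step by (auto simp: V_def)
        next
          case False
          then show ?thesis using step Jcl ijJ by (auto simp: V_def p_def P_def inner_simps)
        qed
      next
        case base
        show ?case by (auto simp: subspace_def inner_simps)
      qed
      \<comment> \<open>The eigenvalue of \<open>x $ i - x $ j\<close> differs by
        \<open>r \<noteq> 0\<close> from that of \<open>V\<close>, so \<open>V\<close> is orthogonal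
        to it.\<close>
      have Vij: "v \<bullet> x $ i = v \<bullet> x $ j" if "v \<in> span V" for v
        using that
      proof (induction rule: span_induct)
        case step
        have "x $ a \<bullet> x $ i = x $ a \<bullet> x $ j" if "a \<in> P" for a
          using nonadj(2)[of a] that r by (simp add: P_def)
        moreover have "p \<bullet> x $ i = p \<bullet> x $ j"
          using xx by (simp add: p_def inner_simps inner_commute)
        ultimately show ?case using step by (auto simp: V_def)
      next
        case base
        show ?case by (auto simp: subspace_def inner_simps)
      qed
      have fin: "finite P" by simp
      have "real (card P) + (p \<bullet> p) / 2 = 2 * real (dim V)"
        unfolding V_def
      proof (rule trace_identity[OF fin])
        fix v assume "v \<in> span (insert p (($) x ` P))"
        then have v: "v \<in> span V" by (simp add: V_def)
        have ijP: "i \<notin> P" "j \<notin> P" by (auto simp: P_def)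
        have "2 * (v \<bullet> v) = (\<Sum>l\<in>UNIV. (v \<bullet> x $ l)\<^sup>2)"
          using half_tight_sum_inner[OF x, of v v] by (simp add: power2_eq_square)
        also have "\<dots> = (\<Sum>l\<in>insert i (insert j P). (v \<bullet> x $ l)\<^sup>2)"
          by (rule sum.mono_neutral_right) (auto simp: Vout[OF v])
        also have "\<dots> = (\<Sum>l\<in>P. (v \<bullet> x $ l)\<^sup>2) + ((v \<bullet> x $ i)\<^sup>2 + (v \<bullet> x $ j)\<^sup>2)"
          using ij ijP by simp
        also have "(v \<bullet> x $ i)\<^sup>2 + (v \<bullet> x $ j)\<^sup>2 = (v \<bullet> p)\<^sup>2 / 2"
          using Vij[OF v] by (simp add: p_def inner_simps power2_eq_square)
        finally show "(\<Sum>l\<in>P. (v \<bullet> x $ l)\<^sup>2) + (v \<bullet> p)\<^sup>2 / 2 = 2 * (v \<bullet> v)" by simp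
      qed (rule xx)
      moreover have "p \<bullet> p = 2 + 2 * (x $ i \<bullet> x $ j)"
        using xx by (simp add: p_def inner_simps inner_commute)
      ultimately have "x $ i \<bullet> x $ j = of_int (2 * int (dim V) - int (card P) - 1)"
        by (simp add: field_simps)
      then obtain z :: int where z: "x $ i \<bullet> x $ j = of_int z" by blast
      then have "\<bar>z\<bar> < 1" using m(2) by (metis of_int_abs of_int_less_1_iff)
      then show False using m(1) z by simp
    qed
    have key': "b v (x $ l) + d $ l * (v \<bullet> x $ l) = 0" if "l \<in> J" "v \<in> W" for l v
      using key[OF that] \<open>r = 0\<close> by simp
    have orth: "x $ a \<bullet> x $ l = 0" if "a \<in> J" "l \<in> J" "d $ a \<noteq> d $ l" for a l
    proof -
      have "b (x $ a) (x $ l) + d $ l * (x $ a \<bullet> x $ l) = 0"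
        "b (x $ l) (x $ a) + d $ a * (x $ a \<bullet> x $ l) = 0"
        using key'[OF that(2) xW[OF that(1)]] key'[OF that(1) xW[OF that(2)]]
        by (simp_all add: inner_commute)
      then have "d $ l * (x $ a \<bullet> x $ l) = d $ a * (x $ a \<bullet> x $ l)"
        using b_simps(1)[of "x $ a" "x $ l"] by linarith
      then show ?thesis using that(3) by simp
    qed
    \<comment> \<open>For \<open>r = 0\<close>, vectors with different \<open>d\<close> are
      orthogonal, and \<open>j\<close> shares the value of \<open>i\<close> because
      \<open>m(1)\<close> excludes orthogonality. Minimality of \<open>J\<close> then makes
      \<open>d\<close> constant on \<open>J\<close>.\<close>
    have "admissible {l \<in> J. d $ l = d $ i}"
      unfolding admissible_def using ijJ m(1) orth Jcl by (smt (verit, best) mem_Collect_eq subset_iff)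
    then have dconst: "d $ l = d $ i" if "l \<in> J" for l
      using Jmin[of "{l \<in> J. d $ l = d $ i}"] that by blast
    \<comment> \<open>On \<open>W\<close> the form \<open>b\<close> is \<open>- d $ i\<close> times
      the inner product, so the contributions of \<open>S\<close> and \<open>d\<close> cancel on
      every variation in \<open>E\<close>, also to second order.\<close>
    have form: "b v u + d $ i * (v \<bullet> u) = 0" if v: "v \<in> W" and u: "u \<in> W" for v u
      using u unfolding W_def
    proof (induction rule: span_induct)
      case step
      then show ?case using key'[OF _ v] dconst by auto
    next
      case base
      have "b v (y + z) + d $ i * (v \<bullet> (y + z)) = (b v y + d $ i * (v \<bullet> y)) + (b v z + d $ i * (v \<bullet> z))"
        "b v (c *\<^sub>R y) + d $ i * (v \<bullet> (c *\<^sub>R y)) = c * (b v y + d $ i * (v \<bullet> y))" for y z c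
        by (simp_all add: b_simps(3,4) inner_add_right algebra_simps)
      then show ?case
        by (auto simp: subspace_def b_simps(2))
    qed
    have "w \<bullet> frame_bilinear i j e e = 0" if e: "e \<in> E" for e
    proof -
      have "b (e $ l) (e $ l) + d $ l * (e $ l \<bullet> e $ l) = 0" for l
      proof (cases "l \<in> J")
        case True
        then show ?thesis using form[of "e $ l" "e $ l"] e dconst by (simp add: E_def)
      next
        case False
        then show ?thesis using e by (simp add: E_def b_simps)
      qed
      then show ?thesis
        unfolding wSdr inner_frame_bilinear b_def[symmetric] using \<open>r = 0\<close>
        by (simp flip: sum.distrib)
    qed
    then show ?thesis using \<open>r = 0\<close> by (simp add: wSdr \<phi>_def)
  qed
  obtain \<gamma> \<epsilon> where \<gamma>: "\<epsilon> > 0" "continuous_on {0..\<epsilon>} \<gamma>" "\<gamma> 0 = x"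
    "\<And>t. t \<in> {0..\<epsilon>} \<Longrightarrow> \<gamma> t - x \<in> E \<and>
       frame_bilinear i j (\<gamma> t) (\<gamma> t) = frame_bilinear i j x x + t *\<^sub>R \<phi>"
    using quadratic_path[OF bounded_bilinear_frame_bilinear frame_bilinear_commute E ortho] by metis
  have step: "\<gamma> t \<in> half_tight_frames" "\<gamma> t $ i \<bullet> \<gamma> t $ j = x $ i \<bullet> x $ j + t * s" if "t \<in> {0..\<epsilon>}" for t
    using frame_bilinear_step[OF x, of i j "\<gamma> t" t s] \<gamma>(4)[OF that] by (auto simp: \<phi>_def)
  show ?thesis
  proof
    show "connected (\<gamma> ` {0..\<epsilon>})" by (intro connected_continuous_image \<gamma>(2)) simp
    show "\<gamma> ` {0..\<epsilon>} \<subseteq> half_tight_frames" using step by auto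
    show "x \<in> \<gamma> ` {0..\<epsilon>}" "\<gamma> \<epsilon> \<in> \<gamma> ` {0..\<epsilon>}" using \<gamma>(1,3) by force+
    show "z $ l = x $ l" if z: "z \<in> \<gamma> ` {0..\<epsilon>}" and l: "l \<notin> J0" for z l
    proof -
      have "z - x \<in> E" using \<gamma>(4) z by auto
      then have "(z - x) $ l = 0" using l ijJ(3) unfolding E_def by blast
      then show ?thesis by simp
    qed
    show "\<bar>\<gamma> \<epsilon> $ i \<bullet> \<gamma> \<epsilon> $ j\<bar> > \<bar>x $ i \<bullet> x $ j\<bar>"
      using step(2)[of \<epsilon>] \<gamma>(1) m(1) by (auto simp: s_def sgn_if abs_if)
  qed
qed

section \<open>Reduction to doubled orthonormal bases\<close>

lemma compact_half_tight_frames: "compact (half_tight_frames :: (real^'n^'k) set)"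
proof -
  have "closed (half_tight_frames :: (real^'n^'k) set)"
    unfolding half_tight_frames_def
    by (intro closed_Collect_conj closed_Collect_all closed_Collect_eq continuous_intros)
  moreover have "bounded (half_tight_frames :: (real^'n^'k) set)"
  proof (rule boundedI)
    fix x :: "real^'n^'k" assume "x \<in> half_tight_frames"
    then have "(\<Sum>j\<in>UNIV. norm (x $ j)) = real CARD('k)"
      by (simp add: half_tight_frames_def)
    then show "norm x \<le> real CARD('k)"
      using L2_set_le_sum[of UNIV "\<lambda>j. norm (x $ j)"] by (simp add: norm_vec_def)
  qed
  ultimately show ?thesis by (simp add: compact_eq_bounded_closed)
qed

lemma half_tight_abs_inner_le: "x \<in> half_tight_frames \<Longrightarrow> \<bar>x $ i \<bullet> x $ j\<bar> \<le> 1"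
  using Cauchy_Schwarz_ineq2[of "x $ i" "x $ j"] by (simp add: half_tight_frames_def)

text \<open>The squares of the numbers \<open>x $ i \<bullet> x $ a\<close> sum to 2, and the
  indices \<open>i\<close> and \<open>j\<close> already use up this total.\<close>

lemma half_tight_partner_orthogonal:
  assumes x: "x \<in> half_tight_frames" and ij: "i \<noteq> j" "\<bar>x $ i \<bullet> x $ j\<bar> = 1" and l: "l \<noteq> i" "l \<noteq> j"
  shows "x $ i \<bullet> x $ l = 0"
proof -
  have "(\<Sum>a\<in>{i, j, l}. (x $ i \<bullet> x $ a)\<^sup>2) \<le> (\<Sum>a\<in>UNIV. (x $ i \<bullet> x $ a)\<^sup>2)"
    by (rule sum_mono2) auto
  also have "\<dots> = 2"
    using half_tight_sum_inner[OF x, of "x $ i" "x $ i"] half_tight_inner_self[OF x, of i]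
    by (simp add: power2_eq_square)
  finally have "1 + ((x $ i \<bullet> x $ j)\<^sup>2 + (x $ i \<bullet> x $ l)\<^sup>2) \<le> 2"
    using ij(1) l half_tight_inner_self[OF x, of i] by auto
  moreover have "(x $ i \<bullet> x $ j)\<^sup>2 = 1" using ij(2) by (metis power2_abs one_power2)
  ultimately show ?thesis by simp
qed

text \<open>For half-tight frames this says that the vectors are those of an orthonormal basis, each
  occurring exactly twice up to sign.\<close>

definition doubled_basis :: "real^'n^'k \<Rightarrow> bool" where
  "doubled_basis x \<longleftrightarrow> (\<forall>i j. x $ i \<bullet> x $ j \<in> {-1, 0, 1})"

text \<open>The index \<open>i\<close> itself supplies only 1 of the total 2 of the squared inner
  products, so another entry is nonzero.\<close>

lemma doubled_basis_partner:
  assumes x: "x \<in> half_tight_frames" and d: "doubled_basis x"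
  obtains j where "j \<noteq> i" "\<bar>x $ i \<bullet> x $ j\<bar> = 1"
proof -
  have "(\<Sum>a\<in>UNIV. (x $ i \<bullet> x $ a)\<^sup>2) = 2"
    using half_tight_sum_inner[OF x, of "x $ i" "x $ i"] half_tight_inner_self[OF x, of i]
    by (simp add: power2_eq_square)
  then have "(\<Sum>a\<in>UNIV - {i}. (x $ i \<bullet> x $ a)\<^sup>2) = 1"
    using half_tight_inner_self[OF x, of i] by (simp add: sum_diff1)
  then have "\<not> (\<forall>a\<in>UNIV - {i}. (x $ i \<bullet> x $ a)\<^sup>2 = 0)"
    using sum.neutral[of "UNIV - {i}" "\<lambda>a. (x $ i \<bullet> x $ a)\<^sup>2"] by linarith
  then obtain j where j: "j \<noteq> i" "x $ i \<bullet> x $ j \<noteq> 0" by auto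
  moreover have "x $ i \<bullet> x $ j \<in> {-1, 0, 1}" using d unfolding doubled_basis_def by blast
  then have "\<bar>x $ i \<bullet> x $ j\<bar> = 1" using j(2) by auto
  ultimately show ?thesis using that by blast
qed

lemma inner_abs_1_imp_eq:
  fixes u v :: "'a::real_inner"
  assumes "u \<bullet> u = 1" "v \<bullet> v = 1" "\<bar>u \<bullet> v\<bar> = 1"
  shows "v = (u \<bullet> v) *\<^sub>R u"
proof -
  have "(u \<bullet> v) * (u \<bullet> v) = 1" using assms(3) by (auto simp: abs_if split: if_splits)
  then have "(v - (u \<bullet> v) *\<^sub>R u) \<bullet> (v - (u \<bullet> v) *\<^sub>R u) = 0"
    using assms(1,2) by (simp add: inner_simps inner_commute)
  then show ?thesis by simp
qed

text \<open>Take a frame in the component with the most parallel pairs. If it is not a doubled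
  basis, freeze all paired vectors and maximize one remaining inner product over a compact
  component; by \<open>increase_abs_inner\<close> the maximum is 1, which creates a further
  pair.\<close>

lemma connects_to_doubled_basis:
  assumes x: "x \<in> half_tight_frames"
  obtains y where "connected_component half_tight_frames x y" "doubled_basis y"
proof -
  define pairs where "pairs y = {(i, j). i \<noteq> j \<and> \<bar>y $ i \<bullet> y $ j\<bar> = 1}" for y :: "real^'a^'b"
  have "connected_component half_tight_frames x x" using x by simp
  moreover have "card (pairs y) < Suc (card (UNIV :: ('b \<times> 'b) set))" for y :: "real^'a^'b"
    by (intro le_imp_less_Suc card_mono) auto
  ultimately obtain y where y: "connected_component half_tight_frames x y"
    and ymax: "\<And>z. connected_component half_tight_frames x z \<Longrightarrow> card (pairs z) \<le> card (pairs y)"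
    using ex_has_greatest_nat[of "connected_component half_tight_frames x" x "\<lambda>y. card (pairs y)"]
    by blast
  have yH: "y \<in> half_tight_frames" using y by (rule connected_component_in[THEN conjunct2])
  have "doubled_basis y"
  proof (rule ccontr)
    assume "\<not> doubled_basis y"
    then obtain i j where "y $ i \<bullet> y $ j \<notin> {-1, 0, 1}" by (auto simp: doubled_basis_def)
    then have m: "y $ i \<bullet> y $ j \<noteq> 0" "\<bar>y $ i \<bullet> y $ j\<bar> < 1"
      using half_tight_abs_inner_le[OF yH, of i j] by auto
    have ij: "i \<noteq> j" using m half_tight_inner_self[OF yH] by auto
    define J where "J = {l. \<forall>a. a \<noteq> l \<longrightarrow> \<bar>y $ l \<bullet> y $ a\<bar> \<noteq> 1}"
    have ijJ: "i \<in> J" "j \<in> J"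
      using half_tight_partner_orthogonal[OF yH] m ij unfolding J_def
      by (smt (verit, best) inner_commute mem_Collect_eq)+
    define F where "F = half_tight_frames \<inter> {z. \<forall>l. l \<in> - J \<longrightarrow> z $ l = y $ l}"
    have "closed {z. \<forall>l. l \<in> - J \<longrightarrow> z $ l = y $ l}"
      by (intro closed_Collect_all closed_Collect_imp open_Collect_const closed_Collect_eq continuous_intros)
    then have "compact F"
      unfolding F_def by (intro compact_Int_closed compact_half_tight_frames)
    then have "compact (connected_component_set F y)"
      using closed_connected_component[of F y] bounded_subset[OF _ connected_component_subset, of F y]
      by (simp add: compact_eq_bounded_closed)
    moreover have yF: "y \<in> F" using yH by (simp add: F_def)
    then have "connected_component_set F y \<noteq> {}" by (metis connected_component_eq_empty)
    moreover have "continuous_on (connected_component_set F y) (\<lambda>z. \<bar>z $ i \<bullet> z $ j\<bar>)"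
      by (intro continuous_intros)
    ultimately obtain z where z: "connected_component F y z"
      and zmax: "\<And>w. connected_component F y w \<Longrightarrow> \<bar>w $ i \<bullet> w $ j\<bar> \<le> \<bar>z $ i \<bullet> z $ j\<bar>"
      using continuous_attains_sup[of "connected_component_set F y" "\<lambda>z. \<bar>z $ i \<bullet> z $ j\<bar>"]
      by (metis mem_Collect_eq)
    have zF: "z \<in> F" using z by (rule connected_component_in[THEN conjunct2])
    then have zH: "z \<in> half_tight_frames" and zy: "\<And>l. l \<notin> J \<Longrightarrow> z $ l = y $ l"
      by (auto simp: F_def)
    have partner: "\<exists>p. p \<noteq> l \<and> p \<notin> J \<and> \<bar>y $ l \<bullet> y $ p\<bar> = 1" if "l \<notin> J" for l
      using that unfolding J_def by (smt (verit, best) inner_commute mem_Collect_eq)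
    \<comment> \<open>A frozen vector keeps its frozen partner and is therefore orthogonal to all
      other vectors of \<open>z\<close>. This is the decoupling that
      \<open>increase_abs_inner\<close> requires.\<close>
    have closed: "z $ a \<bullet> z $ l = 0" if a: "a \<in> J" and l: "l \<notin> J" for a l
    proof -
      obtain p where p: "p \<noteq> l" "p \<notin> J" "\<bar>y $ l \<bullet> y $ p\<bar> = 1" using partner[OF l] by blast
      then have "z $ l \<bullet> z $ a = 0"
        using half_tight_partner_orthogonal[OF zH, of l p a] zy l a by force
      then show ?thesis by (simp add: inner_commute)
    qed
    have z0: "z $ i \<bullet> z $ j \<noteq> 0" using zmax[of y] yF m(1) by auto
    have "\<bar>z $ i \<bullet> z $ j\<bar> = 1"
    proof (rule ccontr)
      assume "\<bar>z $ i \<bullet> z $ j\<bar> \<noteq> 1"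
      then have "\<bar>z $ i \<bullet> z $ j\<bar> < 1" using half_tight_abs_inner_le[OF zH, of i j] by linarith
      then obtain C w where C: "connected C" "C \<subseteq> half_tight_frames" "z \<in> C" "w \<in> C"
        "\<And>v l. v \<in> C \<Longrightarrow> l \<notin> J \<Longrightarrow> v $ l = z $ l" "\<bar>w $ i \<bullet> w $ j\<bar> > \<bar>z $ i \<bullet> z $ j\<bar>"
        using increase_abs_inner[OF zH ijJ closed z0] by metis
      then have "C \<subseteq> F" using zy by (auto simp: F_def)
      then have "connected_component F z w"
        using C(1,3,4) by (auto simp: connected_component_def)
      then have "connected_component F y w" using z by (rule connected_component_trans[rotated])
      then show False using zmax[of w] C(6) by simp
    qed
    then have "(i, j) \<in> pairs z - pairs y" using ij m(2) by (simp add: pairs_def)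
    moreover have "pairs y \<subseteq> pairs z"
    proof clarify
      fix a b assume "(a, b) \<in> pairs y"
      then have ab: "a \<noteq> b" "\<bar>y $ a \<bullet> y $ b\<bar> = 1" by (auto simp: pairs_def)
      then have "a \<notin> J" "b \<notin> J" by (auto simp: J_def inner_commute)
      then show "(a, b) \<in> pairs z" using ab zy by (simp add: pairs_def)
    qed
    ultimately have "card (pairs y) < card (pairs z)"
      by (intro psubset_card_mono) auto
    moreover have "connected_component half_tight_frames y z"
      by (rule connected_component_of_subset[OF z]) (auto simp: F_def)
    then have "connected_component half_tight_frames x z"
      by (rule connected_component_trans[OF y])
    ultimately show False using ymax[of z] by simp
  qed
  then show ?thesis using that y by blast
qed

section \<open>Right-angle rotations of orthogonal pairs\<close>

definition quarter_turn :: "'k \<Rightarrow> 'k \<Rightarrow> real^'n^'k \<Rightarrow> real^'n^'k" where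
  "quarter_turn p q y = (\<chi> l. if l = p then y $ q else if l = q then - y $ p else y $ l)"

lemma quarter_turn_nth:
  "quarter_turn p q y $ l = (if l = p then y $ q else if l = q then - y $ p else y $ l)"
  by (simp add: quarter_turn_def)

text \<open>Rotating two vectors into each other preserves their joint contribution to the frame
  operator; orthogonality keeps them of unit length along the way.\<close>

lemma connected_component_quarter_turn:
  assumes y: "y \<in> half_tight_frames" and pq: "p \<noteq> q" "y $ p \<bullet> y $ q = 0"
  shows "connected_component half_tight_frames y (quarter_turn p q y)"
proof -
  define z where "z t = (\<chi> l. if l = p then cos t *\<^sub>R y $ p + sin t *\<^sub>R y $ q
      else if l = q then cos t *\<^sub>R y $ q - sin t *\<^sub>R y $ p else y $ l)" for t
  have zH: "z t \<in> half_tight_frames" for t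
  proof -
    have yy: "y $ l \<bullet> y $ l = 1" for l by (rule half_tight_inner_self[OF y])
    have cs: "cos t * cos t + sin t * sin t = 1"
      using sin_cos_squared_add2[of t] by simp
    have "z t $ l \<bullet> z t $ l = 1" for l
      using pq cs yy by (simp add: z_def inner_simps inner_commute add.commute)
    then have "norm (z t $ l) = 1" for l by (simp add: norm_eq_sqrt_inner)
    moreover have "(\<Sum>l\<in>UNIV. (v \<bullet> z t $ l) *\<^sub>R z t $ l) = (\<Sum>l\<in>UNIV. (v \<bullet> y $ l) *\<^sub>R y $ l)" for v
    proof -
      have split: "(\<Sum>l\<in>UNIV. f l) = f p + f q + (\<Sum>l\<in>UNIV - {p, q}. f l)" for f :: "'b \<Rightarrow> real^'a"
        using pq(1) sum.subset_diff[of "{p, q}" UNIV f] by (simp add: add.commute)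
      have "(v \<bullet> (c *\<^sub>R P + s *\<^sub>R Q)) *\<^sub>R (c *\<^sub>R P + s *\<^sub>R Q) + (v \<bullet> (c *\<^sub>R Q - s *\<^sub>R P)) *\<^sub>R (c *\<^sub>R Q - s *\<^sub>R P)
          = (c * c + s * s) *\<^sub>R ((v \<bullet> P) *\<^sub>R P + (v \<bullet> Q) *\<^sub>R Q)" for c s :: real and P Q
        by (simp add: inner_simps algebra_simps)
      from this[of "cos t" "y $ p" "sin t" "y $ q"]
      have "(v \<bullet> z t $ p) *\<^sub>R z t $ p + (v \<bullet> z t $ q) *\<^sub>R z t $ q
          = (v \<bullet> y $ p) *\<^sub>R y $ p + (v \<bullet> y $ q) *\<^sub>R y $ q"
        unfolding cs using pq(1) by (simp add: z_def)
      moreover have "(\<Sum>l\<in>UNIV - {p, q}. (v \<bullet> z t $ l) *\<^sub>R z t $ l) = (\<Sum>l\<in>UNIV - {p, q}. (v \<bullet> y $ l) *\<^sub>R y $ l)"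
        by (rule sum.cong) (auto simp: z_def)
      ultimately show ?thesis
        by (simp add: split[of "\<lambda>l. (v \<bullet> z t $ l) *\<^sub>R z t $ l"] split[of "\<lambda>l. (v \<bullet> y $ l) *\<^sub>R y $ l"])
    qed
    ultimately show ?thesis using y by (simp add: half_tight_frames_def)
  qed
  have "continuous_on {0..pi/2} z"
    unfolding z_def
  proof (rule continuous_on_vec_lambda)
    fix l
    show "continuous_on {0..pi/2} (\<lambda>t. if l = p then cos t *\<^sub>R y $ p + sin t *\<^sub>R y $ q
      else if l = q then cos t *\<^sub>R y $ q - sin t *\<^sub>R y $ p else y $ l)"
      by (cases "l = p"; cases "l = q") (simp_all add: continuous_intros)
  qed
  then have "connected (z ` {0..pi/2})" by (intro connected_continuous_image) auto
  moreover have "z 0 = y" "z (pi/2) = quarter_turn p q y"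
    by (auto simp: z_def quarter_turn_def vec_eq_iff)
  then have "y \<in> z ` {0..pi/2}" "quarter_turn p q y \<in> z ` {0..pi/2}"
    by (force intro: image_eqI[of _ _ 0] image_eqI[of _ _ "pi/2"])+
  ultimately show ?thesis
    unfolding connected_component_def using zH by (intro exI[of _ "z ` {0..pi/2}"]) auto
qed

lemma doubled_basis_quarter_turn: "doubled_basis y \<Longrightarrow> doubled_basis (quarter_turn p q y)"
  unfolding doubled_basis_def quarter_turn_nth by (auto simp del: inner_eq_zero_iff)

section \<open>Connecting doubled orthonormal bases\<close>

text \<open>Parallel vectors cannot be turned against each other, so a sign is changed with the help
  of a second pair: the positions are paired crosswise and then paired back.\<close>

lemma flip_one_pair:
  fixes y :: "real^'n^'k"
  assumes y: "y \<in> half_tight_frames" and doubled: "doubled_basis y"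
    and dist: "distinct [a, a', b, b']"
    and a: "\<bar>y $ a \<bullet> y $ a'\<bar> = 1" and b: "\<bar>y $ b \<bullet> y $ b'\<bar> = 1"
  obtains z where "connected_component half_tight_frames y z" "doubled_basis z"
    "z $ a \<bullet> z $ a' = - (y $ a \<bullet> y $ a')" "z $ b \<bullet> z $ b' = y $ b \<bullet> y $ b'"
    "\<And>l. l \<notin> {a, a', b, b'} \<Longrightarrow> z $ l = y $ l"
proof -
  note yy = half_tight_inner_self[OF y]
  define e where "e = y $ a"
  define f where "f = y $ b"
  define s where "s = y $ a \<bullet> y $ a'"
  define t where "t = y $ b \<bullet> y $ b'"
  have y_a': "y $ a' = s *\<^sub>R e" and y_b': "y $ b' = t *\<^sub>R f"
    using inner_abs_1_imp_eq[OF yy yy a] inner_abs_1_imp_eq[OF yy yy b]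
    by (simp_all add: e_def f_def s_def t_def)
  have ef: "e \<bullet> f = 0" "f \<bullet> e = 0" "e \<bullet> e = 1" "f \<bullet> f = 1"
    using half_tight_partner_orthogonal[OF y _ a, of b] dist yy
    by (auto simp: e_def f_def inner_commute)
  have st: "s * s = 1" "t * t = 1"
    using a b unfolding s_def t_def by (auto simp: abs_if split: if_splits)
  have st_cases: "s = t \<or> s = - t"
    using a b unfolding s_def t_def by (auto simp: abs_if split: if_splits)
  define y1 where "y1 = quarter_turn a' b' y"
  define y2 where "y2 = quarter_turn a a' y1"
  have y1: "y1 $ a = e" "y1 $ a' = t *\<^sub>R f" "y1 $ b = f" "y1 $ b' = - s *\<^sub>R e"
    using dist y_a' y_b' by (auto simp: y1_def quarter_turn_nth e_def f_def)
  have y2: "y2 $ a = t *\<^sub>R f" "y2 $ a' = - e" "y2 $ b = f" "y2 $ b' = - s *\<^sub>R e"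
    using dist y1 by (auto simp: y2_def quarter_turn_nth)
  have c1: "connected_component half_tight_frames y y1"
    unfolding y1_def using y dist by (intro connected_component_quarter_turn) (auto simp: y_a' y_b' ef)
  then have y1H: "y1 \<in> half_tight_frames" by (rule connected_component_in[THEN conjunct2])
  have c2: "connected_component half_tight_frames y1 y2"
    unfolding y2_def using y1H dist by (intro connected_component_quarter_turn) (auto simp: y1 ef)
  then have y2H: "y2 \<in> half_tight_frames" by (rule connected_component_in[THEN conjunct2])
  have d2: "doubled_basis y2"
    unfolding y2_def y1_def by (intro doubled_basis_quarter_turn doubled)
  have rest: "y2 $ l = y $ l" if "l \<notin> {a, a', b, b'}" for l
    using that by (simp add: y2_def y1_def quarter_turn_nth)
  \<comment> \<open>In \<open>y2\<close> the pairs are \<open>{a, b}\<close> and \<open>{a', b'}\<close>; both turns restore the original pairs, negating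
    exactly one sign, and which of the two depends on whether \<open>s = t\<close>.\<close>
  define z where "z = (if s = t then quarter_turn b a' y2 else quarter_turn a' b y2)"
  have c3: "connected_component half_tight_frames y2 z"
    unfolding z_def using y2H dist by (auto intro!: connected_component_quarter_turn simp: y2 ef)
  show ?thesis
  proof
    show "connected_component half_tight_frames y z"
      using c1 c2 c3 connected_component_trans by metis
    show "doubled_basis z"
      using doubled_basis_quarter_turn[OF d2] by (simp add: z_def)
    show "z $ l = y $ l" if "l \<notin> {a, a', b, b'}" for l
      using that rest[OF that] by (simp add: z_def quarter_turn_nth)
    have "z $ a \<bullet> z $ a' = - s" "z $ b \<bullet> z $ b' = t"
      using dist st_cases ef st by (auto simp: z_def quarter_turn_nth y2)
    then show "z $ a \<bullet> z $ a' = - (y $ a \<bullet> y $ a')" "z $ b \<bullet> z $ b' = y $ b \<bullet> y $ b'"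
      by (simp_all add: s_def t_def)
  qed
qed

text \<open>Among the doubled bases in the component, one agreeing with \<open>x0\<close> in the
  most nonzero off-diagonal Gram entries is chosen. A wrong entry could be repaired without spoiling
  a correct one: by a quarter turn if it is 0, by \<open>flip_one_pair\<close> if only its sign is
  wrong.\<close>

lemma connects_to_same_Gram:
  fixes x x0 :: "real^'n^'k"
  assumes card: "CARD('k) > 2"
    and x0: "x0 \<in> half_tight_frames" "doubled_basis x0"
    and x: "x \<in> half_tight_frames"
  obtains y where "connected_component half_tight_frames x y" "\<And>i j. y $ i \<bullet> y $ j = x0 $ i \<bullet> x0 $ j"
proof -
  define good where
    "good y = {(i, j). i \<noteq> j \<and> x0 $ i \<bullet> x0 $ j \<noteq> 0 \<and> y $ i \<bullet> y $ j = x0 $ i \<bullet> x0 $ j}" for y :: "real^'n^'k"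
  define P where "P y \<longleftrightarrow> connected_component half_tight_frames x y \<and> doubled_basis y" for y :: "real^'n^'k"
  obtain y' where "P y'" using connects_to_doubled_basis[OF x] unfolding P_def by blast
  moreover have "card (good y) < Suc (card (UNIV :: ('k \<times> 'k) set))" for y
    by (intro le_imp_less_Suc card_mono) auto
  ultimately obtain y where Py: "P y" and ymax: "\<And>z. P z \<Longrightarrow> card (good z) \<le> card (good y)"
    using ex_has_greatest_nat[of P y' "\<lambda>y. card (good y)"] by blast
  have xy: "connected_component half_tight_frames x y" and dy: "doubled_basis y"
    using Py by (auto simp: P_def)
  have yH: "y \<in> half_tight_frames" using xy by (rule connected_component_in[THEN conjunct2])
  note yy = half_tight_inner_self[OF yH]
  have improve: False
    if z: "connected_component half_tight_frames y z" "doubled_basis z"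
      and sub: "good y \<subseteq> good z" and new: "(i, j) \<in> good z - good y" for z i j
  proof -
    have "P z" using z connected_component_trans[OF xy] by (simp add: P_def)
    moreover have "card (good y) < card (good z)"
      using sub new by (intro psubset_card_mono) auto
    ultimately show False using ymax[of z] by simp
  qed
  have abs1: "\<bar>u $ i \<bullet> u $ j\<bar> = 1 \<longleftrightarrow> u $ i \<bullet> u $ j \<noteq> 0" if "doubled_basis u" for u :: "real^'n^'k" and i j
    using that unfolding doubled_basis_def by (smt (verit, best) insertE singletonD)
  have partner: "b = c" if "u \<in> half_tight_frames" "doubled_basis u"
    "u $ a \<bullet> u $ b \<noteq> 0" "u $ a \<bullet> u $ c \<noteq> 0" "a \<noteq> b" "a \<noteq> c" for u :: "real^'n^'k" and a b c
    using half_tight_partner_orthogonal[OF that(1) that(5), of c] abs1[OF that(2)] that by auto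
  have same: "y $ i \<bullet> y $ j = x0 $ i \<bullet> x0 $ j" if ij: "i \<noteq> j" "x0 $ i \<bullet> x0 $ j \<noteq> 0" for i j
  proof (rule ccontr)
    assume bad: "y $ i \<bullet> y $ j \<noteq> x0 $ i \<bullet> x0 $ j"
    \<comment> \<open>Partners in \<open>x0\<close> are unique, so a correct pair meeting
      \<open>i\<close> or \<open>j\<close> would be the wrong pair itself.\<close>
    have goodD: "a \<notin> {i, j}" "b \<notin> {i, j}" "a \<noteq> b" "y $ a \<bullet> y $ b \<noteq> 0" if "(a, b) \<in> good y" for a b
    proof -
      have ab: "a \<noteq> b" "x0 $ a \<bullet> x0 $ b \<noteq> 0" "y $ a \<bullet> y $ b = x0 $ a \<bullet> x0 $ b"
        using that by (auto simp: good_def)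
      have impl: "a = i \<Longrightarrow> b = j" "a = j \<Longrightarrow> b = i" "b = i \<Longrightarrow> a = j" "b = j \<Longrightarrow> a = i"
        using partner[OF x0, of a b] partner[OF x0, of b a] ab(1,2) ij
        by (metis inner_commute)+
      have "\<not> (a = i \<and> b = j)" using ab(3) bad by blast
      moreover have "\<not> (a = j \<and> b = i)" using ab(3) bad by (metis inner_commute)
      ultimately show "a \<notin> {i, j}" "b \<notin> {i, j}" using impl by blast+
      show "a \<noteq> b" "y $ a \<bullet> y $ b \<noteq> 0" using ab by simp_all
    qed
    show False
    proof (cases "y $ i \<bullet> y $ j = 0")
      case True
      obtain i' where i': "i' \<noteq> i" "\<bar>y $ i \<bullet> y $ i'\<bar> = 1"
        using doubled_basis_partner[OF yH dy] by blast
      have i'j: "i' \<noteq> j" using i'(2) True by auto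
      define s where "s = y $ i \<bullet> y $ i'"
      have y_i': "y $ i' = s *\<^sub>R y $ i"
        using inner_abs_1_imp_eq[OF yy yy i'(2)] by (simp add: s_def)
      \<comment> \<open>Either turn moves the partner of \<open>i\<close> into position
        \<open>j\<close>; the choice of direction gives the inner product the sign prescribed by
        \<open>x0\<close>.\<close>
      define z where "z = (if x0 $ i \<bullet> x0 $ j = s then quarter_turn j i' y else quarter_turn i' j y)"
      have "connected_component half_tight_frames y z"
        unfolding z_def using yH i'j True
        by (auto intro!: connected_component_quarter_turn simp: y_i' inner_commute)
      moreover have "doubled_basis z"
        using doubled_basis_quarter_turn[OF dy] by (simp add: z_def)
      moreover have rest: "z $ l = y $ l" if "l \<noteq> i'" "l \<noteq> j" for l
        using that by (simp add: z_def quarter_turn_nth)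
      have "(i, j) \<in> good z - good y"
      proof -
        have "x0 $ i \<bullet> x0 $ j = s \<or> x0 $ i \<bullet> x0 $ j = - s"
          using abs1[OF x0(2), of i j] ij(2) i'(2) unfolding s_def by linarith
        then have "z $ i \<bullet> z $ j = x0 $ i \<bullet> x0 $ j"
          using i' i'j ij(1) yy by (auto simp: z_def quarter_turn_nth y_i')
        then show ?thesis using ij bad by (auto simp: good_def)
      qed
      moreover have "good y \<subseteq> good z"
      proof clarify
        fix a b assume ab: "(a, b) \<in> good y"
        have "y $ i' \<bullet> y $ i \<noteq> 0" using i'(2) by (auto simp: inner_commute)
        moreover have "a \<noteq> i" "b \<noteq> i" "y $ b \<bullet> y $ a \<noteq> 0" using goodD[OF ab] by (auto simp: inner_commute)
        ultimately have "a \<noteq> i'" "b \<noteq> i'"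
          using goodD(3,4)[OF ab] partner[OF yH dy, of i' i] i'(1) by metis+
        then show "(a, b) \<in> good z" using ab goodD[OF ab] rest by (auto simp: good_def)
      qed
      ultimately show False using improve by blast
    next
      case False
      \<comment> \<open>Here the bound on \<open>CARD('k)\<close> supplies the second pair for the
        sign change.\<close>
      have "\<exists>b. b \<notin> {i, j}"
      proof (rule ccontr)
        assume "\<nexists>b. b \<notin> {i, j}"
        then have "card (UNIV :: 'k set) \<le> card {i, j}" by (intro card_mono) auto
        also have "\<dots> \<le> 2" by (simp add: card_insert_if)
        finally show False using card by simp
      qed
      then obtain b where b: "b \<noteq> i" "b \<noteq> j" by auto
      obtain b' where b': "b' \<noteq> b" "\<bar>y $ b \<bullet> y $ b'\<bar> = 1"
        using doubled_basis_partner[OF yH dy] by blast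
      have yij: "\<bar>y $ i \<bullet> y $ j\<bar> = 1" using abs1[OF dy] False by blast
      have "y $ i \<bullet> y $ b = 0" "y $ j \<bullet> y $ b = 0"
        using partner[OF yH dy, of i j b] partner[OF yH dy, of j i b] False b ij(1)
        by (auto simp: inner_commute)
      then have "b' \<noteq> i" "b' \<noteq> j" using b'(2) by (auto simp: inner_commute)
      then have dist: "distinct [i, j, b, b']" using b b'(1) ij(1) by auto
      obtain z where z: "connected_component half_tight_frames y z" "doubled_basis z"
        "z $ i \<bullet> z $ j = - (y $ i \<bullet> y $ j)" "z $ b \<bullet> z $ b' = y $ b \<bullet> y $ b'"
        "\<And>l. l \<notin> {i, j, b, b'} \<Longrightarrow> z $ l = y $ l"
        using flip_one_pair[OF yH dy dist yij b'(2)] by metis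
      have "(i, j) \<in> good z - good y"
        using z(3) bad yij abs1[OF x0(2), of i j] ij by (auto simp: good_def)
      moreover have "good y \<subseteq> good z"
      proof clarify
        fix c d assume cd: "(c, d) \<in> good y"
        have nij: "c \<noteq> i" "c \<noteq> j" "d \<noteq> i" "d \<noteq> j" and cd0: "c \<noteq> d" "y $ c \<bullet> y $ d \<noteq> 0"
          using goodD[OF cd] by auto
        have "z $ c \<bullet> z $ d = y $ c \<bullet> y $ d"
        proof (cases "c \<in> {b, b'} \<or> d \<in> {b, b'}")
          case True
          have "y $ b \<bullet> y $ b' \<noteq> 0" "y $ b' \<bullet> y $ b \<noteq> 0" "y $ d \<bullet> y $ c \<noteq> 0"
            using b'(2) cd0(2) by (auto simp: inner_commute)
          then have "c = b \<Longrightarrow> d = b'" "c = b' \<Longrightarrow> d = b" "d = b \<Longrightarrow> c = b'" "d = b' \<Longrightarrow> c = b"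
            using partner[OF yH dy, of b b'] partner[OF yH dy, of b' b] b'(1) cd0 by metis+
          then have "(c = b \<and> d = b') \<or> (c = b' \<and> d = b)" using True by blast
          then show ?thesis using z(4) by (auto simp: inner_commute)
        next
          case False
          then show ?thesis using z(5) nij by simp
        qed
        then show "(c, d) \<in> good z" using cd by (simp add: good_def)
      qed
      ultimately show False using improve z(1,2) by blast
    qed
  qed
  \<comment> \<open>A zero entry follows from the nonzero ones: the partner of \<open>i\<close> in
    \<open>x0\<close> is also its partner in \<open>y\<close>, which leaves \<open>y $ j\<close>
    orthogonal to \<open>y $ i\<close>.\<close>
  have "y $ i \<bullet> y $ j = x0 $ i \<bullet> x0 $ j" for i j
  proof (cases "i = j \<or> x0 $ i \<bullet> x0 $ j \<noteq> 0")
    case True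
    then show ?thesis using same[of i j] yy half_tight_inner_self[OF x0(1)] by fastforce
  next
    case False
    obtain p where p: "p \<noteq> i" "\<bar>x0 $ i \<bullet> x0 $ p\<bar> = 1"
      using doubled_basis_partner[OF x0] by blast
    have "\<bar>y $ i \<bullet> y $ p\<bar> = 1" using same[of i p] p by auto
    moreover have "j \<noteq> p" using False p(2) by auto
    ultimately have "y $ i \<bullet> y $ j = 0"
      using half_tight_partner_orthogonal[OF yH, of i p j] p(1) False by auto
    then show ?thesis using False by simp
  qed
  then show ?thesis using that xy by blast
qed

section \<open>The orthogonal group action\<close>

text \<open>Acting by maps lets reflections, compositions and inverses enter without matrices, which
  return only for \<open>frame_orbit\<close>.\<close>

definition vector_action :: "(real^'n \<Rightarrow> real^'n) \<Rightarrow> real^'n^'k \<Rightarrow> real^'n^'k" where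
  "vector_action f x = (\<chi> l. f (x $ l))"

lemma vector_action_nth: "vector_action f x $ l = f (x $ l)"
  by (simp add: vector_action_def)

lemma vector_action_half_tight:
  assumes f: "orthogonal_transformation f" and x: "x \<in> half_tight_frames"
  shows "vector_action f x \<in> half_tight_frames"
proof -
  have lin: "linear f" using f by (rule orthogonal_transformation_linear)
  have "(\<Sum>l\<in>UNIV. (v \<bullet> f (x $ l)) *\<^sub>R f (x $ l)) = 2 *\<^sub>R v" for v
  proof -
    obtain w where w: "v = f w"
      using orthogonal_transformation_surj[OF f] by (metis surjD)
    have "(\<Sum>l\<in>UNIV. (v \<bullet> f (x $ l)) *\<^sub>R f (x $ l)) = f (\<Sum>l\<in>UNIV. (w \<bullet> x $ l) *\<^sub>R x $ l)"
      using f by (simp add: w linear_sum[OF lin] linear_cmul[OF lin] orthogonal_transformation_def)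
    also have "\<dots> = 2 *\<^sub>R v"
      using x by (simp add: half_tight_frames_def linear_cmul[OF lin] w)
    finally show ?thesis .
  qed
  then show ?thesis
    using x f by (simp add: half_tight_frames_def vector_action_nth orthogonal_transformation_norm)
qed

lemma connected_component_vector_action:
  assumes f: "orthogonal_transformation f"
    and xy: "connected_component half_tight_frames x y"
  shows "connected_component half_tight_frames (vector_action f x) (vector_action f y)"
proof -
  obtain T where T: "connected T" "T \<subseteq> half_tight_frames" "x \<in> T" "y \<in> T"
    using xy by (auto simp: connected_component_def)
  have "bounded_linear f"
    using orthogonal_transformation_linear[OF f] by (simp add: linear_conv_bounded_linear)
  then have "continuous_on T (vector_action f)"
    unfolding vector_action_def
    by (intro continuous_on_vec_lambda bounded_linear.continuous_on[of f] continuous_intros)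
  then have "connected (vector_action f ` T)"
    using T(1) by (rule connected_continuous_image)
  then show ?thesis
    unfolding connected_component_def using T vector_action_half_tight[OF f]
    by (intro exI[of _ "vector_action f ` T"]) blast
qed

section \<open>Hyperplane reflections and their deformation\<close>

definition reflection :: "'a::real_inner \<Rightarrow> 'a \<Rightarrow> 'a" where
  "reflection u v = v - (2 * (u \<bullet> v)) *\<^sub>R u"

lemma reflection_involutive: "u \<bullet> u = 1 \<Longrightarrow> reflection u (reflection u v) = v"
  by (simp add: reflection_def inner_simps algebra_simps)

lemma orthogonal_transformation_reflection:
  assumes "u \<bullet> u = 1"
  shows "orthogonal_transformation (reflection u)"
proof -
  have "linear (reflection u)"
    by (intro linearI) (simp_all add: reflection_def inner_simps algebra_simps)
  moreover have "reflection u v \<bullet> reflection u w = v \<bullet> w" for v w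
    using assms by (simp add: reflection_def inner_simps inner_commute)
  ultimately show ?thesis by (simp add: orthogonal_transformation_def)
qed

text \<open>The unit normals form a sphere, which is connected in dimension at least 2.\<close>

lemma connected_component_reflections:
  fixes x :: "real^'n^'k"
  assumes n: "CARD('n) \<ge> 2" and x: "x \<in> half_tight_frames"
    and uv: "u \<bullet> u = 1" "v \<bullet> v = 1"
  shows "connected_component half_tight_frames (vector_action (reflection u) x) (vector_action (reflection v) x)"
proof -
  let ?T = "(\<lambda>w. vector_action (reflection w) x) ` sphere 0 1"
  have "connected (sphere (0::real^'n) 1)"
    using n by (intro connected_sphere) simp
  moreover have "continuous_on (sphere 0 1) (\<lambda>w. vector_action (reflection w) x)"
    unfolding vector_action_def reflection_def by (intro continuous_on_vec_lambda continuous_intros)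
  ultimately have "connected ?T" by (intro connected_continuous_image)
  moreover have "?T \<subseteq> half_tight_frames"
    using x by (auto intro!: vector_action_half_tight orthogonal_transformation_reflection simp: dot_square_norm)
  moreover have "u \<in> sphere 0 1" "v \<in> sphere 0 1"
    using uv by (simp_all add: norm_eq_sqrt_inner)
  ultimately show ?thesis
    unfolding connected_component_def by (intro exI[of _ ?T]) blast
qed

text \<open>This follows the factorization of an orthogonal map into reflections: each induction
  step composes with the reflection taking \<open>f b\<close> to \<open>b\<close>, so one more basis
  vector is fixed.\<close>

lemma orthogonal_fixing_up_to_reflection:
  fixes f :: "real^'n \<Rightarrow> real^'n"
  assumes n: "CARD('n) \<ge> 2" and v: "v \<bullet> v = 1" and fin: "finite S"
    and f: "orthogonal_transformation f" "\<And>c. c \<in> Basis - S \<Longrightarrow> f c = c"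
    and x: "x \<in> (half_tight_frames :: (real^'n^'k) set)"
  shows "connected_component half_tight_frames (vector_action f x) x \<or>
    connected_component half_tight_frames (vector_action f x) (vector_action (reflection v) x)"
  using fin f
proof (induction S arbitrary: f rule: finite_induct)
  case empty
  have "f = (\<lambda>w. w)"
    using empty by (intro linear_eq_stdbasis orthogonal_transformation_linear) auto
  then have "vector_action f x = x" by (simp add: vector_action_def)
  then show ?case using x by simp
next
  case (insert b S)
  show ?case
  proof (cases "f b = b")
    case True
    then show ?thesis using insert.prems by (intro insert.IH) auto
  next
    case False
    have ff: "f c \<bullet> f d = c \<bullet> d" for c d
      using insert.prems(1) by (simp add: orthogonal_transformation_def)
    define w where "w = f b - b"
    define u where "u = w /\<^sub>R norm w"
    have w0: "norm w \<noteq> 0" using False by (simp add: w_def)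
    have u: "u \<bullet> u = 1" using w0 by (simp add: u_def dot_square_norm)
    have R: "orthogonal_transformation (reflection u)"
      using u by (rule orthogonal_transformation_reflection)
    have refl: "reflection u c = c - (2 * (w \<bullet> c) / (w \<bullet> w)) *\<^sub>R w" for c
      by (simp add: reflection_def u_def dot_square_norm power2_eq_square divide_simps)
    \<comment> \<open>Hence the reflection subtracts exactly \<open>w\<close> from
      \<open>f b\<close>, which leaves \<open>b\<close>.\<close>
    have ww: "w \<bullet> w = 2 * (w \<bullet> f b)"
      using ff[of b b] by (simp add: w_def inner_simps inner_commute)
    define g where "g = reflection u \<circ> f"
    have g: "orthogonal_transformation g"
      unfolding g_def using R insert.prems(1) by (rule orthogonal_transformation_compose)
    have "g b = b"
      using w0 by (simp add: g_def refl flip: ww) (simp add: w_def)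
    moreover have "g c = c" if "c \<in> Basis - insert b S" for c
    proof -
      have "f c = c" using that by (rule insert.prems(2))
      moreover from this have "w \<bullet> c = 0"
        using ff[of b c] by (simp add: w_def inner_simps)
      ultimately show ?thesis by (simp add: g_def refl)
    qed
    ultimately have "connected_component half_tight_frames (vector_action g x) x \<or>
      connected_component half_tight_frames (vector_action g x) (vector_action (reflection v) x)"
      using g by (intro insert.IH) auto
    moreover have gf: "vector_action (reflection u) (vector_action g x) = vector_action f x"
      using u by (simp add: vector_action_def g_def reflection_involutive)
    moreover have "connected_component half_tight_frames (vector_action (reflection u) x) (vector_action (reflection v) x)"
      by (rule connected_component_reflections[OF n x u v])
    \<comment> \<open>Deforming \<open>u\<close> into \<open>v\<close> turns the product of the two
      reflections into the identity.\<close>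
    moreover have "connected_component half_tight_frames
        (vector_action (reflection u) (vector_action (reflection v) x)) x"
      using connected_component_reflections[OF n
          vector_action_half_tight[OF orthogonal_transformation_reflection[OF v] x] u v] v
      by (simp add: vector_action_def reflection_involutive)
    ultimately show ?thesis
      using connected_component_vector_action[OF R, of "vector_action g x"] connected_component_trans
      by metis
  qed
qed

lemma orthogonal_up_to_reflection:
  fixes x :: "real^'n^'k"
  assumes n: "CARD('n) \<ge> 2" and v: "v \<bullet> v = 1" and f: "orthogonal_transformation f"
    and x: "x \<in> half_tight_frames"
  shows "connected_component half_tight_frames (vector_action f x) x \<or>
    connected_component half_tight_frames (vector_action f x) (vector_action (reflection v) x)"
  using orthogonal_fixing_up_to_reflection[OF n v finite_Basis f _ x] by blast

text \<open>The map expands a vector in the frame \<open>x\<close> and puts the vectors of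
  \<open>y\<close> in place of those of \<open>x\<close>; the inner products of the results depend
  only on the Gram matrix.\<close>

lemma same_Gram_imp_orthogonal_image:
  assumes x: "x \<in> half_tight_frames" and y: "y \<in> half_tight_frames"
    and gram: "\<And>i j. y $ i \<bullet> y $ j = x $ i \<bullet> x $ j"
  obtains f where "orthogonal_transformation f" "y = vector_action f x"
proof
  define f where "f v = (1/2) *\<^sub>R (\<Sum>l\<in>UNIV. (v \<bullet> x $ l) *\<^sub>R y $ l)" for v
  have "linear f"
    by (intro linearI) (simp_all add: f_def inner_add_left scaleR_add_left sum.distrib scaleR_add_right
        scaleR_sum_right mult.left_commute)
  moreover have "f v \<bullet> f w = v \<bullet> w" for v w
  proof -
    have x_id: "v = (1/2) *\<^sub>R (\<Sum>l\<in>UNIV. (v \<bullet> x $ l) *\<^sub>R x $ l)" for v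
      using x by (simp add: half_tight_frames_def)
    have "f v \<bullet> f w = ((1/2) *\<^sub>R (\<Sum>l\<in>UNIV. (v \<bullet> x $ l) *\<^sub>R x $ l)) \<bullet> ((1/2) *\<^sub>R (\<Sum>l\<in>UNIV. (w \<bullet> x $ l) *\<^sub>R x $ l))"
      by (simp add: f_def inner_sum_left inner_sum_right gram)
    then show ?thesis using x_id by metis
  qed
  ultimately show "orthogonal_transformation f" by (simp add: orthogonal_transformation_def)
  show "y = vector_action f x"
  proof -
    have "f (x $ j) = y $ j" for j
      using y by (simp add: f_def half_tight_frames_def flip: gram)
    then show ?thesis by (simp add: vec_eq_iff vector_action_nth)
  qed
qed

section \<open>Counting the components and connectedness of the quotient\<close>

theorem mainTheorem5:
  fixes F :: "(real^'n^'k) set"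
  assumes "CARD('n) \<ge> 2" and "CARD('k) = 2 * CARD('n)"
    and "F = unit_norm_tight_frames"
  shows "finite (components F) \<and> card (components F) \<le> 2 \<and>
    connected_space (quotient_topology (top_of_set F) frame_orbit)"
proof (cases "F = {}")
  \<comment> \<open>Treating the empty set apart spares an explicit construction of a frame.\<close>
  case True
  have "topspace (quotient_topology (top_of_set F) (frame_orbit :: real^'n^'k \<Rightarrow> _)) = {}"
    by (simp add: topspace_quotient_topology True)
  then have "connected_space (quotient_topology (top_of_set F) (frame_orbit :: real^'n^'k \<Rightarrow> _))"
    by (metis connectedin_empty connectedin_topspace)
  then show ?thesis using True by simp
next
  case False
  have F: "F = half_tight_frames"
    using assms(2,3) unit_norm_tight_frames_eq_half_tight by blast
  have card: "CARD('k) > 2" using assms(1,2) by linarith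
  obtain x0 where x0: "x0 \<in> F" "doubled_basis x0"
    using False connects_to_doubled_basis connected_component_in unfolding F by (metis ex_in_conv)
  have orbit: "\<exists>f. orthogonal_transformation f \<and> connected_component F x (vector_action f x0)"
    if x: "x \<in> F" for x
  proof -
    obtain y where y: "connected_component F x y" "\<And>i j. y $ i \<bullet> y $ j = x0 $ i \<bullet> x0 $ j"
      using connects_to_same_Gram[OF card x0[unfolded F] x[unfolded F]] unfolding F by metis
    have "y \<in> F" using y(1) by (rule connected_component_in[THEN conjunct2])
    then obtain f where "orthogonal_transformation f" "y = vector_action f x0"
      using same_Gram_imp_orthogonal_image[OF x0(1)[unfolded F] _ y(2)] F by metis
    then show ?thesis using y(1) by blast
  qed
  obtain v :: "real^'n" where v: "v \<bullet> v = 1"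
    using vector_choose_size[of 1] by (metis dot_square_norm one_power2 zero_le_one)
  have "components F \<subseteq> {connected_component_set F x0, connected_component_set F (vector_action (reflection v) x0)}"
  proof
    fix K assume "K \<in> components F"
    then obtain x where x: "x \<in> F" "K = connected_component_set F x"
      by (auto simp: components_def)
    obtain f where f: "orthogonal_transformation f" "connected_component F x (vector_action f x0)"
      using orbit[OF x(1)] by blast
    then have "connected_component F x x0 \<or> connected_component F x (vector_action (reflection v) x0)"
      using orthogonal_up_to_reflection[OF assms(1) v f(1) x0(1)[unfolded F]]
        connected_component_trans[of F x] unfolding F by blast
    then show "K \<in> {connected_component_set F x0, connected_component_set F (vector_action (reflection v) x0)}"
      unfolding x(2) using connected_component_eq[of _ F x] by blast
  qed
  then have "finite (components F)" "card (components F) \<le> card {connected_component_set F x0, connected_component_set F (vector_action (reflection v) x0)}"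
    by (auto intro: finite_subset card_mono)
  moreover have "card {A, B} \<le> 2" for A B :: "(real^'n^'k) set"
    by (simp add: card_insert_if)
  moreover have "connected_space (quotient_topology (top_of_set F) frame_orbit)"
  proof -
    let ?Q = "quotient_topology (top_of_set F) frame_orbit"
    let ?C = "connected_component_set F x0"
    \<comment> \<open>Undoing the orthogonal map that relates \<open>x\<close> to \<open>x0\<close>
      moves \<open>x\<close> into the component of \<open>x0\<close>, so this one connected set
      covers the quotient.\<close>
    have "frame_orbit x \<in> frame_orbit ` ?C" if x: "x \<in> F" for x
    proof -
      obtain f where f: "orthogonal_transformation f" "connected_component F x (vector_action f x0)"
        using orbit[OF x] by blast
      obtain g where g: "orthogonal_transformation g" "g \<circ> f = id"
        using f(1) orthogonal_transformation_inv[OF f(1)] orthogonal_transformation_inj[OF f(1)]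
        by (metis inv_o_cancel)
      have "connected_component F (vector_action g x) (vector_action g (vector_action f x0))"
        using connected_component_vector_action[OF g(1)] f(2) unfolding F by blast
      moreover have "vector_action g (vector_action f x0) = x0"
        using g(2) by (simp add: vector_action_def vec_eq_iff fun_eq_iff)
      ultimately have "vector_action g x \<in> ?C" by (simp add: connected_component_sym)
      moreover have "frame_orbit x = frame_orbit (vector_action g x)"
        unfolding frame_orbit_eq_iff
        using g(1) orthogonal_transformation_matrix[of g]
        by (intro exI[of _ "matrix g"])
          (simp add: frame_action_def vector_action_def matrix_works orthogonal_transformation_linear)
      ultimately show ?thesis by blast
    qed
    then have "topspace ?Q = frame_orbit ` ?C"
      using connected_component_subset[of F x0] by (auto simp: topspace_quotient_topology)
    moreover have "connectedin (top_of_set F) ?C"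
      by (simp add: connectedin_subtopology connectedin_iff_connected connected_component_subset)
    then have "connectedin ?Q (frame_orbit ` ?C)"
      by (rule connectedin_continuous_map_image[OF quotient_imp_continuous_map[OF quotient_map_quotient_topology]])
    ultimately show ?thesis by (simp flip: connectedin_topspace)
  qed
  ultimately show ?thesis by (meson le_trans)
qed

end
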